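(* Let $L=\bigcup_{n<\omega}L_n$ be an infinite alphabet, where $L_0\subseteq L_1\subseteq\cdots$ are finite sets. For every finite colouring of $W_L$ there is a variable-free word $w_0\in W_L$ together with an infinite sequence $X=(x_n)_{n<\omega}$ of left-variable words such that the set $\{w_0{}^\frown w: w\in[X]^*_L\}$ is monochromatic.
   Context: Let $v$ be a symbol not in $L$. $W_L$ is the set of all finite words over $L$, i.e. functions $w:n\to L$ with $n<\omega$; $W_{Lv}$ is the set of variable words, i.e. functions $x:n\to L\cup\{v\}$ with $n<\omega$ and $v$ in the range of $x$. A left-variable word is a variable word whose first letter is $v$. $x^\frown y$ denotes concatenation. For a variable word $x$ and $\lambda\in L$, $x[\lambda]$ is the word obtained by replacing every occurrence of $v$ in $x$ by $\lambda$. For a sequence $X=(x_n)_{n<\omega}$ in $W_{Lv}$, $[X]^*_L$ is the set of all words of the form $x_0[\lambda_0]^\frown x_1[\lambda_1]^\frown\cdots^\frown x_k[\lambda_k]$ with $k<\omega$ and $\lambda_i\in L_i$ for each $i\le k$. *)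

theory Defs
  imports Main
begin

text \<open>Finite words over an alphabet L are the elements of \<^term>\<open>lists L\<close>. The variable v, a symbol
  outside L, is \<^term>\<open>None\<close>, and a letter a of L occurs in a variable word as \<^term>\<open>Some a\<close>.\<close>

definition variable_words :: "'a set \<Rightarrow> 'a option list set" where
  "variable_words L = {x \<in> lists (insert None (Some ` L)). None \<in> set x}"

definition left_variable_words :: "'a set \<Rightarrow> 'a option list set" where
  "left_variable_words L = {x \<in> variable_words L. hd x = None}"

definition subst_var :: "'a option list \<Rightarrow> 'a \<Rightarrow> 'a list" where
  "subst_var x l = map (\<lambda>s. case s of None \<Rightarrow> l | Some a \<Rightarrow> a) x"

text \<open>The set of constant words generated by the sequence X; every product uses a nonempty initial
  segment of X, with no term skipped, and the i-th letter is taken from the i-th set \<^term>\<open>A i\<close>.\<close>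

definition generated_words :: "(nat \<Rightarrow> 'a set) \<Rightarrow> (nat \<Rightarrow> 'a option list) \<Rightarrow> 'a list set" where
  "generated_words A X =
     {concat (map (\<lambda>i. subst_var (X i) (l i)) [0..<Suc k]) | k l. \<forall>i\<le>k. l i \<in> A i}"

definition monochromatic :: "('b \<Rightarrow> 'c) \<Rightarrow> 'b set \<Rightarrow> bool" where
  "monochromatic c S \<longleftrightarrow> (\<exists>k. \<forall>s\<in>S. c s = k)"

end

theory Submission
  imports Defs "HOL-Analysis.Analysis"
begin

text \<open>The ultrafilters on words form a compact semigroup in which right translations are continuous.
  Let J be a minimal closed left ideal of the ultrafilters on words over L. The ultrafilters r on
  left-variable words over L all of whose substitution images r[a], for a in L, lie in J form a
  nonempty closed subsemigroup, so by Ellis' lemma some such r is idempotent. Then all r[a] are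
  idempotents of J, and minimality of J gives r[a] r[b] = r[a] for all a and b in L.

  Let B be a colour class belonging to some r[a], and call a word w in B good at stage n if
  {y. w y in B} belongs to r[a] for every a in A n. By r[a] r[b] = r[a], if w is good at
  stage n, then r-almost every x makes w x[a] good at stage n + 1 for all a in A n. As only
  finitely many words arise at each stage, the terms of X can be chosen one after another.\<close>

section \<open>Minimal closed sets and idempotents in compact semigroups\<close>

text \<open>That compact sets are closed is an explicit hypothesis below because function types are not
  declared as instances of \<^class>\<open>t2_space\<close>.\<close>

lemma minimal_compact_subset:
  fixes S :: "'b::topological_space set"
  assumes closed: "\<And>K :: 'b set. compact K \<Longrightarrow> closed K"
    and S: "compact S" "S \<noteq> {}" "P S"
    and Inter: "\<And>F. F \<noteq> {} \<Longrightarrow> \<forall>T\<in>F. P T \<Longrightarrow> P (\<Inter>F)"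
  obtains M where "M \<subseteq> S" "compact M" "M \<noteq> {}" "P M"
    "\<And>T. T \<subseteq> M \<Longrightarrow> compact T \<Longrightarrow> T \<noteq> {} \<Longrightarrow> P T \<Longrightarrow> T = M"
proof -
  define \<A> where "\<A> = {T. T \<subseteq> S \<and> compact T \<and> T \<noteq> {} \<and> P T}"
  \<comment> \<open>Zorn's lemma for reverse inclusion, so the maximal element obtained is minimal
    for inclusion.\<close>
  have "\<exists>M\<in>\<A>. \<forall>T\<in>\<A>. M \<supseteq> T \<longrightarrow> T = M"
  proof (rule predicate_Zorn)
    show "partial_order_on \<A> (relation_of (\<lambda>M T. M \<supseteq> T) \<A>)"
      by (auto intro!: partial_order_on_relation_ofI)
  next
    fix C assume "C \<in> Chains (relation_of (\<lambda>M T. M \<supseteq> T) \<A>)"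
    then have C: "C \<subseteq> \<A>" and chain: "\<And>T U. T \<in> C \<Longrightarrow> U \<in> C \<Longrightarrow> T \<subseteq> U \<or> U \<subseteq> T"
      by (auto simp: Chains_def relation_of_def)
    show "\<exists>U\<in>\<A>. \<forall>T\<in>C. T \<supseteq> U"
    proof (cases "C = {}")
      case True
      then show ?thesis
        using S by (intro bexI[of _ S]) (simp_all add: \<A>_def)
    next
      case False
      have closed_C: "closed T" if "T \<in> C" for T
        using C that by (auto simp: \<A>_def intro: closed)
      \<comment> \<open>Compactness of \<open>S\<close> reduces this to finite subfamilies of the
        chain, and a nonempty finite one contains its own intersection.\<close>
      have "S \<inter> \<Inter>C \<noteq> {}"
      proof (rule compact_imp_fip[OF \<open>compact S\<close> closed_C])
        fix F assume F: "finite F" "F \<subseteq> C"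
        show "S \<inter> \<Inter>F \<noteq> {}"
        proof (cases "F = {}")
          case True
          then show ?thesis using S by simp
        next
          case False
          then have "\<Inter>F \<in> F"
          proof (intro finite_Inf_in)
            fix T U assume "T \<in> F" "U \<in> F"
            then have "T \<subseteq> U \<or> U \<subseteq> T"
              using F chain by blast
            with \<open>T \<in> F\<close> \<open>U \<in> F\<close> show "T \<inter> U \<in> F"
              by (auto simp: inf.absorb1 inf.absorb2)
          qed (use F in auto)
          then have "\<Inter>F \<in> \<A>"
            using F C by blast
          then show ?thesis
            unfolding \<A>_def by blast
        qed
      qed
      moreover have "compact (\<Inter>C)"
      proof -
        obtain T where "T \<in> C" using False by blast
        then have "compact (T \<inter> \<Inter>C)"
          using C closed_C by (intro compact_Int_closed closed_Inter) (auto simp: \<A>_def)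
        also have "T \<inter> \<Inter>C = \<Inter>C" using \<open>T \<in> C\<close> by blast
        finally show ?thesis .
      qed
      moreover have "P (\<Inter>C)"
        using C False by (intro Inter) (auto simp: \<A>_def)
      ultimately have "\<Inter>C \<in> \<A>"
        using C False by (auto simp: \<A>_def)
      then show ?thesis by blast
    qed
  qed
  then obtain M where M: "M \<in> \<A>" "\<And>T. T \<in> \<A> \<Longrightarrow> T \<subseteq> M \<Longrightarrow> T = M"
    by blast
  show thesis
  proof (rule that)
    fix T assume "T \<subseteq> M" "compact T" "T \<noteq> {}" "P T"
    then show "T = M" using M by (auto simp: \<A>_def)
  qed (use M(1) in \<open>auto simp: \<A>_def\<close>)
qed

text \<open>For \<open>e\<close> in a minimal compact subsemigroup \<open>M\<close>, the translate
  \<open>M e\<close> is a compact subsemigroup inside \<open>M\<close>, so it equals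
  \<open>M\<close> and \<open>m x e = e\<close> has a solution in \<open>M\<close>. The solutions
  again form a compact subsemigroup, so they fill \<open>M\<close>, and \<open>e\<close> is one of
  them.\<close>

lemma Ellis_idempotent:
  fixes m :: "'b::topological_space \<Rightarrow> 'b \<Rightarrow> 'b"
  assumes S: "compact S" "S \<noteq> {}" "\<And>x y. x \<in> S \<Longrightarrow> y \<in> S \<Longrightarrow> m x y \<in> S"
    and assoc: "\<And>x y z. m (m x y) z = m x (m y z)"
    and cont: "\<And>y. continuous_on UNIV (\<lambda>x. m x y)"
    and closed: "\<And>K :: 'b set. compact K \<Longrightarrow> closed K"
  shows "\<exists>e\<in>S. m e e = e"
proof -
  obtain M where M: "M \<subseteq> S" "compact M" "M \<noteq> {}" "\<forall>x\<in>M. \<forall>y\<in>M. m x y \<in> M"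
    and min: "\<And>T. T \<subseteq> M \<Longrightarrow> compact T \<Longrightarrow> T \<noteq> {} \<Longrightarrow> \<forall>x\<in>T. \<forall>y\<in>T. m x y \<in> T \<Longrightarrow> T = M"
    by (rule minimal_compact_subset[where P = "\<lambda>T. \<forall>x\<in>T. \<forall>y\<in>T. m x y \<in> T", OF closed S(1,2)])
      (assumption, simp add: S(3), simp, rule that)
  obtain e where e: "e \<in> M" using M by blast
  have "(\<lambda>x. m x e) ` M = M"
  proof (rule min)
    show "compact ((\<lambda>x. m x e) ` M)"
      using M by (auto intro!: compact_continuous_image continuous_on_subset[OF cont])
    show "\<forall>x\<in>(\<lambda>x. m x e) ` M. \<forall>y\<in>(\<lambda>x. m x e) ` M. m x y \<in> (\<lambda>x. m x e) ` M"
    proof clarify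
      fix x y assume "x \<in> M" "y \<in> M"
      then have "m (m x e) y \<in> M" using M e by blast
      then show "m (m x e) (m y e) \<in> (\<lambda>x. m x e) ` M"
        by (simp add: assoc[symmetric])
    qed
  qed (use M e in auto)
  then have "e \<in> (\<lambda>x. m x e) ` M"
    using e by simp
  then have "{x \<in> M. m x e = e} \<noteq> {}"
    by force
  moreover have "closed ((\<lambda>x. m x e) -` {e})"
    using cont closed[of "{e}"] by (simp add: closed_vimage)
  then have "compact (M \<inter> (\<lambda>x. m x e) -` {e})"
    using M by (intro compact_Int_closed)
  then have "compact {x \<in> M. m x e = e}"
    by (simp add: vimage_def Int_def)
  moreover have "\<forall>x\<in>{x \<in> M. m x e = e}. \<forall>y\<in>{x \<in> M. m x e = e}. m x y \<in> {x \<in> M. m x e = e}"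
    using M by (simp add: assoc)
  ultimately have "{x \<in> M. m x e = e} = M"
    by (intro min) blast+
  then show ?thesis using e M by blast
qed

text \<open>Take \<open>J\<close> minimal among the nonempty compact left ideals. For an idempotent
  \<open>e\<close> in \<open>J\<close>, minimality gives \<open>x = m y e\<close> for some
  \<open>y\<close>, and multiplying by \<open>e\<close> once more changes nothing.\<close>

lemma minimal_left_ideal:
  fixes m :: "'b::topological_space \<Rightarrow> 'b \<Rightarrow> 'b"
  assumes S: "compact S" "S \<noteq> {}" "\<And>x y. x \<in> S \<Longrightarrow> y \<in> S \<Longrightarrow> m x y \<in> S"
    and assoc: "\<And>x y z. m (m x y) z = m x (m y z)"
    and cont: "\<And>y. continuous_on UNIV (\<lambda>x. m x y)"
    and closed: "\<And>K :: 'b set. compact K \<Longrightarrow> closed K"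
  obtains J where "J \<subseteq> S" "compact J" "J \<noteq> {}" "\<And>x y. x \<in> S \<Longrightarrow> y \<in> J \<Longrightarrow> m x y \<in> J"
    "\<And>e x. e \<in> J \<Longrightarrow> m e e = e \<Longrightarrow> x \<in> J \<Longrightarrow> m x e = x"
proof -
  obtain J where J: "J \<subseteq> S" "compact J" "J \<noteq> {}" "\<forall>x\<in>S. \<forall>y\<in>J. m x y \<in> J"
    and min: "\<And>T. T \<subseteq> J \<Longrightarrow> compact T \<Longrightarrow> T \<noteq> {} \<Longrightarrow> \<forall>x\<in>S. \<forall>y\<in>T. m x y \<in> T \<Longrightarrow> T = J"
    by (rule minimal_compact_subset[where P = "\<lambda>T. \<forall>x\<in>S. \<forall>y\<in>T. m x y \<in> T", OF closed S(1,2)])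
      (assumption, simp add: S(3), simp, rule that)
  show thesis
  proof (rule that[OF J(1-3)])
    fix e x assume e: "e \<in> J" "m e e = e" and x: "x \<in> J"
    \<comment> \<open>J e is again a closed left ideal inside J.\<close>
    have "(\<lambda>x. m x e) ` J = J"
    proof (rule min)
      show "compact ((\<lambda>x. m x e) ` J)"
        using J by (auto intro!: compact_continuous_image continuous_on_subset[OF cont])
      show "\<forall>x\<in>S. \<forall>y\<in>(\<lambda>x. m x e) ` J. m x y \<in> (\<lambda>x. m x e) ` J"
        using J by (auto simp: assoc[symmetric])
    qed (use J e in auto)
    then obtain y where "x = m y e" using x by blast
    then show "m x e = x" by (simp add: assoc e)
  qed (use J in auto)
qed

section \<open>Ultrafilters on words as a compact semigroup\<close>

text \<open>An ultrafilter is its membership predicate, so that the product topology on functions into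
  \<^typ>\<open>bool\<close> induces the Stone topology.\<close>

definition ultra :: "('w set \<Rightarrow> bool) \<Rightarrow> bool" where
  "ultra p \<longleftrightarrow> \<not> p {} \<and> (\<forall>A B. p (A \<inter> B) \<longleftrightarrow> p A \<and> p B) \<and> (\<forall>A. p (- A) \<longleftrightarrow> \<not> p A)"

definition ultra_map :: "('v \<Rightarrow> 'w) \<Rightarrow> ('v set \<Rightarrow> bool) \<Rightarrow> 'w set \<Rightarrow> bool" where
  "ultra_map f p A = p (f -` A)"

text \<open>The extension of concatenation to ultrafilters. With \<open>p\<close> outermost, each
  coordinate of the product is a single coordinate of \<open>p\<close>, whence continuity in the
  left argument.\<close>

definition ultra_append :: "('a list set \<Rightarrow> bool) \<Rightarrow> ('a list set \<Rightarrow> bool) \<Rightarrow> 'a list set \<Rightarrow> bool" where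
  "ultra_append p q A = p {x. q {y. x @ y \<in> A}}"

lemma ultra_append_assoc:
  "ultra_append (ultra_append p q) r = ultra_append p (ultra_append q r)"
  by (simp add: ultra_append_def fun_eq_iff)

lemma ultra_empty: "ultra p \<Longrightarrow> \<not> p {}"
  and ultra_Int: "ultra p \<Longrightarrow> p (A \<inter> B) \<longleftrightarrow> p A \<and> p B"
  and ultra_Compl: "ultra p \<Longrightarrow> p (- A) \<longleftrightarrow> \<not> p A"
  by (simp_all add: ultra_def)

lemma ultra_UNIV: "ultra p \<Longrightarrow> p UNIV"
  using ultra_Compl[of p "{}"] ultra_empty by auto

lemma ultra_mono: "ultra p \<Longrightarrow> p A \<Longrightarrow> A \<subseteq> B \<Longrightarrow> p B"
  by (metis inf.absorb_iff1 ultra_Int)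

lemma ultra_INT:
  assumes "ultra p" "finite I" "\<And>i. i \<in> I \<Longrightarrow> p (A i)"
  shows "p (\<Inter>i\<in>I. A i)"
  using assms(2,3) by induction (auto simp: ultra_UNIV ultra_Int assms(1))

lemma ultra_UN:
  assumes "ultra p" "finite I" "p (\<Union>i\<in>I. A i)"
  shows "\<exists>i\<in>I. p (A i)"
proof (rule ccontr)
  assume "\<not> ?thesis"
  then have "p (\<Inter>i\<in>I. - A i)"
    by (intro ultra_INT[OF assms(1,2)]) (simp add: ultra_Compl[OF assms(1)])
  then show False
    using assms ultra_Compl[of p "\<Union>i\<in>I. A i"] by (simp add: uminus_SUP)
qed

lemma ultra_point: "ultra (\<lambda>A. w \<in> A)"
  by (simp add: ultra_def)

lemma ultra_ultra_map: "ultra p \<Longrightarrow> ultra (ultra_map f p)"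
  by (simp add: ultra_def ultra_map_def vimage_Compl)

lemma ultra_ultra_append:
  assumes "ultra p" "ultra q"
  shows "ultra (ultra_append p q)"
  unfolding ultra_def
proof (intro conjI allI)
  show "\<not> ultra_append p q {}"
    using assms by (simp add: ultra_append_def ultra_empty)
  fix A B :: "'a list set"
  have "{y. x @ y \<in> A \<inter> B} = {y. x @ y \<in> A} \<inter> {y. x @ y \<in> B}" for x by blast
  then show "ultra_append p q (A \<inter> B) \<longleftrightarrow> ultra_append p q A \<and> ultra_append p q B"
    by (simp only: ultra_append_def ultra_Int[OF assms(2)] Collect_conj_eq ultra_Int[OF assms(1)])
  have "{y. x @ y \<in> - A} = - {y. x @ y \<in> A}" for x by blast
  then show "ultra_append p q (- A) \<longleftrightarrow> \<not> ultra_append p q A"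
    by (simp only: ultra_append_def ultra_Compl[OF assms(2)] Collect_neg_eq ultra_Compl[OF assms(1)])
qed

text \<open>The space \<open>bool\<close> is Hausdorff and products preserve this. It discharges the
  closedness hypothesis of the semigroup lemmas.\<close>

lemma compact_imp_closed_fun:
  fixes K :: "('i \<Rightarrow> bool) set"
  assumes "compact K"
  shows "closed K"
proof -
  have "Hausdorff_space (euclidean :: bool topology)"
    unfolding Hausdorff_space_def disjnt_def using hausdorff by (metis open_openin)
  then have "Hausdorff_space (product_topology (\<lambda>_::'i. euclidean :: bool topology) UNIV)"
    unfolding Hausdorff_space_product_topology by blast
  then have "Hausdorff_space (euclidean :: ('i \<Rightarrow> bool) topology)"
    by (simp add: euclidean_product_topology)
  then show ?thesis
    using compactin_imp_closedin[of euclidean K] assms by simp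
qed

lemma compact_UNIV_fun: "compact (UNIV :: ('i \<Rightarrow> bool) set)"
proof -
  have "compact_space (euclidean :: bool topology)"
    by (simp add: compact_space_def finite_imp_compact)
  then have "compact_space (product_topology (\<lambda>_::'i. euclidean :: bool topology) UNIV)"
    unfolding compact_space_product_topology by blast
  then show ?thesis
    unfolding euclidean_product_topology compact_space_def by simp
qed

text \<open>Evaluation at three points is continuous into a finite space in which every set is
  closed. Three coordinates cover the intersection axiom of \<open>ultra\<close>; shorter conditions
  fill up with \<open>{}\<close>.\<close>

lemma closed_eval3: "closed {p :: 'i \<Rightarrow> bool. Q (p A) (p B) (p C)}"
proof -
  have "closed ((\<lambda>p :: 'i \<Rightarrow> bool. (p A, p B, p C)) -` {(a, b, c). Q a b c})"
    by (intro closed_vimage finite_imp_closed continuous_on_Pair continuous_on_product_coordinates) auto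
  then show ?thesis by (simp add: vimage_def)
qed

lemma closed_ultra: "closed {p. ultra p}"
  unfolding ultra_def
  by (intro closed_Collect_conj closed_Collect_all closed_eval3[of "\<lambda>a b c. \<not> a" "{}" "{}" "{}"]
      closed_eval3[of "\<lambda>a b c. a \<longleftrightarrow> b \<and> c"] closed_eval3[of "\<lambda>a b c. a \<longleftrightarrow> \<not> b" _ _ "{}"])

lemma continuous_ultra_append: "continuous_on UNIV (\<lambda>p. ultra_append p q)"
  unfolding ultra_append_def
  by (intro continuous_on_coordinatewise_then_product continuous_on_product_coordinates)

lemma continuous_ultra_map: "continuous_on UNIV (ultra_map f)"
  unfolding ultra_map_def
  by (intro continuous_on_coordinatewise_then_product continuous_on_product_coordinates)

section \<open>Substitution, and the idempotent ultrafilter on left-variable words\<close>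

lemma subst_var_append: "subst_var (x @ y) a = subst_var x a @ subst_var y a"
  by (simp add: subst_var_def)

lemma subst_var_in_lists:
  "x \<in> left_variable_words L \<Longrightarrow> a \<in> L \<Longrightarrow> subst_var x a \<in> lists L"
  by (fastforce simp: left_variable_words_def variable_words_def subst_var_def split: option.splits)

lemma append_in_left_variable_words:
  "x \<in> left_variable_words L \<Longrightarrow> y \<in> left_variable_words L \<Longrightarrow> x @ y \<in> left_variable_words L"
  by (cases x) (auto simp: left_variable_words_def variable_words_def)

text \<open>Substitution is a homomorphism for concatenation, and this lifts to ultrafilters; so
  idempotents are carried to idempotents.\<close>

lemma ultra_map_subst_append:
  "ultra_map (\<lambda>x. subst_var x a) (ultra_append r r') =
     ultra_append (ultra_map (\<lambda>x. subst_var x a) r) (ultra_map (\<lambda>x. subst_var x a) r')"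
  by (simp add: fun_eq_iff ultra_map_def ultra_append_def subst_var_append vimage_def)

lemma left_variable_ultrafilter:
  obtains r where "ultra r" "r (left_variable_words L)"
    "\<And>a b. a \<in> L \<Longrightarrow> b \<in> L \<Longrightarrow>
       ultra_append (ultra_map (\<lambda>x. subst_var x a) r) (ultra_map (\<lambda>x. subst_var x b) r) =
       ultra_map (\<lambda>x. subst_var x a) r"
proof -
  let ?T = "\<lambda>a. ultra_map (\<lambda>x. subst_var x a)"
  define S where "S = {p. ultra p \<and> p (lists L)}"
  have "closed S"
    unfolding S_def
    by (intro closed_Collect_conj closed_ultra closed_eval3[of "\<lambda>a b c. a" _ "{}" "{}"])
  then have "compact S"
    using compact_Int_closed[OF compact_UNIV_fun] by fastforce
  have point: "(\<lambda>A. w \<in> A) \<in> S" if "w \<in> lists L" for w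
    using that by (simp add: S_def ultra_point)
  have append: "ultra_append p q \<in> S" if "p \<in> S" "q \<in> S" for p q
  proof -
    have "{x. q {y. x @ y \<in> lists L}} \<supseteq> lists L"
      using that by (auto simp: S_def elim: ultra_mono)
    then show ?thesis
      using that unfolding S_def
      by (auto simp: ultra_ultra_append ultra_append_def elim: ultra_mono)
  qed
  have "S \<noteq> {}"
    using point[of "[]"] by auto
  obtain J where J: "J \<subseteq> S" "compact J" "J \<noteq> {}" "\<And>x y. x \<in> S \<Longrightarrow> y \<in> J \<Longrightarrow> ultra_append x y \<in> J"
    and J_idem: "\<And>e x. e \<in> J \<Longrightarrow> ultra_append e e = e \<Longrightarrow> x \<in> J \<Longrightarrow> ultra_append x e = x"
    by (rule minimal_left_ideal[where m = ultra_append, OF \<open>compact S\<close> \<open>S \<noteq> {}\<close> append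
          ultra_append_assoc continuous_ultra_append compact_imp_closed_fun]) (assumption, assumption, assumption, rule that)
  define K where "K = {r. ultra r \<and> r (left_variable_words L) \<and> (\<forall>a\<in>L. ?T a r \<in> J)}"
  have "closed {r. ?T a r \<in> J}" for a
    using closed_vimage[OF compact_imp_closed_fun[OF J(2)] continuous_ultra_map]
    by (simp add: vimage_def)
  then have "closed {r. \<forall>a\<in>L. ?T a r \<in> J}"
    unfolding Ball_def imp_conv_disj by (intro closed_Collect_all closed_Collect_disj) auto
  then have "closed K"
    unfolding K_def
    by (intro closed_Collect_conj closed_ultra closed_eval3[of "\<lambda>a b c. a" _ "{}" "{}"])
  then have "compact K"
    using compact_Int_closed[OF compact_UNIV_fun] by fastforce
  moreover have "K \<noteq> {}"
  proof -
    obtain p where p: "p \<in> J" using J by blast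
    \<comment> \<open>The variable is put in front of variable-free words distributed by
      \<open>p\<close>: substituting \<open>a\<close> then only prepends the letter
      \<open>a\<close>, and the left ideal \<open>J\<close> absorbs that.\<close>
    define r where "r = ultra_map (\<lambda>w. None # map Some w) p"
    have "p (lists L)" "ultra p" using p J by (auto simp: S_def)
    have "ultra r" using \<open>ultra p\<close> by (simp add: r_def ultra_ultra_map)
    moreover have "r (left_variable_words L)"
      unfolding r_def ultra_map_def
      by (rule ultra_mono[OF \<open>ultra p\<close> \<open>p (lists L)\<close>])
         (auto simp: left_variable_words_def variable_words_def)
    moreover have "?T a r \<in> J" if "a \<in> L" for a
    proof -
      have "?T a r = ultra_append (\<lambda>A. [a] \<in> A) p"
        by (simp add: fun_eq_iff r_def ultra_map_def ultra_append_def subst_var_def vimage_def comp_def)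
      then show ?thesis
        using J(4)[OF point p] that by simp
    qed
    ultimately show ?thesis by (auto simp: K_def)
  qed
  moreover have "ultra_append r r' \<in> K" if "r \<in> K" "r' \<in> K" for r r'
  proof -
    have "{x. r' {y. x @ y \<in> left_variable_words L}} \<supseteq> left_variable_words L"
      using that by (auto simp: K_def intro!: append_in_left_variable_words elim: ultra_mono)
    then have "ultra_append r r' (left_variable_words L)"
      using that by (auto simp: ultra_append_def K_def elim: ultra_mono)
    then show ?thesis
      using that J by (auto simp: K_def ultra_ultra_append ultra_map_subst_append)
  qed
  ultimately have "\<exists>r\<in>K. ultra_append r r = r"
    by (rule Ellis_idempotent[where m = ultra_append, OF _ _ _ ultra_append_assoc continuous_ultra_append compact_imp_closed_fun])
  then obtain r where r: "r \<in> K" "ultra_append r r = r"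
    by blast
  show thesis
  proof (rule that)
    show "ultra r" "r (left_variable_words L)" using r by (auto simp: K_def)
    fix a b assume "a \<in> L" "b \<in> L"
    then have "?T a r \<in> J" "?T b r \<in> J"
      using r(1) by (auto simp: K_def)
    moreover have "ultra_append (?T b r) (?T b r) = ?T b r"
      using r(2) by (simp flip: ultra_map_subst_append)
    \<comment> \<open>\<open>J_idem\<close> is applied with \<open>e = ?T b r\<close>, a right
      identity on \<open>J\<close>, and \<open>x = ?T a r\<close>.\<close>
    ultimately show "ultra_append (?T a r) (?T b r) = ?T a r"
      using J_idem by blast
  qed
qed

section \<open>Recursive choice of the sequence\<close>

text \<open>Dependent choice carries along the finite set \<open>G n\<close> of all words built from
  \<open>w0\<close> and the first \<open>n\<close> terms. The hypothesis \<open>step\<close>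
  supplies one next term serving all of \<open>G n\<close> and \<open>A n\<close> at once;
  finiteness of \<open>A n\<close> keeps \<open>G (Suc n)\<close> finite.\<close>

lemma generated_words_extend:
  fixes good :: "nat \<Rightarrow> 'a list set"
  assumes finite_A: "\<And>n. finite (A n)" and w0: "w0 \<in> good 0"
    and step: "\<And>n G. finite G \<Longrightarrow> G \<subseteq> good n \<Longrightarrow>
      \<exists>x\<in>V. \<forall>w\<in>G. \<forall>a\<in>A n. w @ subst_var x a \<in> good (Suc n)"
  shows "\<exists>X. (\<forall>n. X n \<in> V) \<and> (\<forall>w\<in>generated_words A X. \<exists>n. w0 @ w \<in> good n)"
proof -
  define ext where "ext n G x = (\<lambda>(w, a). w @ subst_var x a) ` (G \<times> A n)" for n G x
  \<comment> \<open>The clause for \<open>n = 0\<close> fixes the start, which could otherwise be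
    any finite subset of \<open>good 0\<close>.\<close>
  have "\<exists>G. \<forall>n. (finite (G n) \<and> G n \<subseteq> good n \<and> (n = 0 \<longrightarrow> G n = {w0})) \<and>
      (\<exists>x\<in>V. G (Suc n) = ext n (G n) x)"
  proof (rule dependent_nat_choice)
    show "\<exists>G. finite G \<and> G \<subseteq> good 0 \<and> ((0::nat) = 0 \<longrightarrow> G = {w0})"
      using w0 by (intro exI[of _ "{w0}"]) auto
  next
    fix G n assume G: "finite G \<and> G \<subseteq> good n \<and> (n = 0 \<longrightarrow> G = {w0})"
    then obtain x where x: "x \<in> V" and good: "\<forall>w\<in>G. \<forall>a\<in>A n. w @ subst_var x a \<in> good (Suc n)"
      using step[of G n] by auto
    have "finite (ext n G x)"
      using G finite_A by (simp add: ext_def)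
    moreover have "ext n G x \<subseteq> good (Suc n)"
      using good by (auto simp: ext_def)
    ultimately show "\<exists>H. (finite H \<and> H \<subseteq> good (Suc n) \<and> (Suc n = 0 \<longrightarrow> H = {w0})) \<and>
        (\<exists>x\<in>V. H = ext n G x)"
      using x by blast
  qed
  then obtain G where "\<forall>n. (finite (G n) \<and> G n \<subseteq> good n \<and> (n = 0 \<longrightarrow> G n = {w0})) \<and>
      (\<exists>x\<in>V. G (Suc n) = ext n (G n) x)" ..
  then have G: "G 0 = {w0}" "\<And>n. G n \<subseteq> good n" "\<And>n. \<exists>x\<in>V. G (Suc n) = ext n (G n) x"
    by simp_all
  from G(3) obtain X where X: "\<And>n. X n \<in> V" "\<And>n. G (Suc n) = ext n (G n) (X n)"
    by metis
  \<comment> \<open>\<open>G n\<close> sees the terms with index below \<open>n\<close>, so a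
    generated word whose last term has index \<open>k\<close> lands, after the prefix
    \<open>w0\<close>, in \<open>G (Suc k)\<close>.\<close>
  have "w0 @ concat (map (\<lambda>i. subst_var (X i) (l i)) [0..<n]) \<in> G n"
    if "\<forall>i<n. l i \<in> A i" for l n
    using that
  proof (induction n)
    case 0
    then show ?case by (simp add: G)
  next
    case (Suc n)
    let ?w = "w0 @ concat (map (\<lambda>i. subst_var (X i) (l i)) [0..<n])"
    have "?w \<in> G n" "l n \<in> A n"
      using Suc by auto
    then have "?w @ subst_var (X n) (l n) \<in> G (Suc n)"
      unfolding X(2) ext_def by (intro rev_image_eqI[of "(?w, l n)"]) simp_all
    then show ?case by simp
  qed
  then have "\<exists>n. w0 @ w \<in> good n" if "w \<in> generated_words A X" for w
    using that G(2) unfolding generated_words_def less_Suc_eq_le[symmetric] by blast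
  then show ?thesis using X(1) by blast
qed

section \<open>Good words in a colour class\<close>

theorem theorem4p2:
  fixes A :: "nat \<Rightarrow> 'a set" and L :: "'a set" and c :: "'a list \<Rightarrow> 'c"
  assumes L: "L = (\<Union>n. A n)"
    and infinite_L: "infinite L"
    and finite_A: "\<And>n. finite (A n)"
    and mono_A: "\<And>n. A n \<subseteq> A (Suc n)"
    and finite_colouring: "finite (c ` lists L)"
  shows "\<exists>w0 \<in> lists L. \<exists>X. (\<forall>n. X n \<in> left_variable_words L) \<and>
           monochromatic c {w0 @ w | w. w \<in> generated_words A X}"
proof -
  obtain r where r: "ultra r" "r (left_variable_words L)"
    and r_idem: "\<And>a b. a \<in> L \<Longrightarrow> b \<in> L \<Longrightarrow>
       ultra_append (ultra_map (\<lambda>x. subst_var x a) r) (ultra_map (\<lambda>x. subst_var x b) r) =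
       ultra_map (\<lambda>x. subst_var x a) r"
    by (rule left_variable_ultrafilter[where L = L]) (rule that)
  define s where "s = (\<lambda>a. ultra_map (\<lambda>x. subst_var x a) r)"
  have s: "ultra (s a)" for a
    by (simp add: s_def r ultra_ultra_map)
  have s_append: "s a {x. s b {y. x @ y \<in> B}} \<longleftrightarrow> s a B" if "a \<in> L" "b \<in> L" for a b B
    using fun_cong[OF r_idem[OF that], of B] by (simp add: s_def ultra_append_def)
  have A_L: "A n \<subseteq> L" for n using L by blast
  \<comment> \<open>An arbitrary letter, used to select the colour class and
    \<open>w0\<close>.\<close>
  obtain a0 where a0: "a0 \<in> L" using infinite_L by fastforce
  have "s a0 (lists L)"
    unfolding s_def ultra_map_def
    by (rule ultra_mono[OF r]) (use subst_var_in_lists[OF _ a0] in blast)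
  also have "lists L = (\<Union>k\<in>c ` lists L. {w \<in> lists L. c w = k})" by blast
  finally obtain k where k: "s a0 {w \<in> lists L. c w = k}"
    using ultra_UN[OF s finite_colouring] by blast
  define B where "B = {w \<in> lists L. c w = k}"
  \<comment> \<open>Quantifying over the finite set \<open>A n\<close> in place of \<open>L\<close>
    keeps the intersection in \<open>good_eq\<close> finite, as \<open>ultra_INT\<close>
    demands.\<close>
  define good where "good n = {w \<in> B. \<forall>a\<in>A n. s a {y. w @ y \<in> B}}" for n
  have good_eq: "{y. w @ y \<in> good n} =
      {y. w @ y \<in> B} \<inter> (\<Inter>a\<in>A n. {y. s a {z. (w @ y) @ z \<in> B}})" for w n
    by (auto simp: good_def)
  \<comment> \<open>The hypothesis concerns the single letter \<open>a\<close>, the conclusion all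
    letters of \<open>A n\<close>: by \<open>s_append\<close>, for \<open>s a\<close>-almost every
    \<open>y\<close>, the word \<open>w @ y\<close> is completed into \<open>B\<close> by
    \<open>s b\<close>-almost every \<open>z\<close>.\<close>
  have s_good: "s a {y. w @ y \<in> good n}" if "a \<in> L" "s a {y. w @ y \<in> B}" for a w n
    unfolding good_eq ultra_Int[OF s]
  proof (intro conjI ultra_INT[OF s finite_A])
    fix b assume "b \<in> A n"
    then show "s a {y. s b {z. (w @ y) @ z \<in> B}}"
      using s_append[OF \<open>a \<in> L\<close>, of b "{z. w @ z \<in> B}"] A_L that by auto
  qed fact
  \<comment> \<open>With the empty word for \<open>w\<close>, \<open>s_good\<close> puts
    \<open>good 0\<close> into the ultrafilter \<open>s a0\<close>, so it is nonempty.\<close>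
  obtain w0 where w0: "w0 \<in> good 0"
    using s_good[OF a0, of "[]" 0] k ultra_empty[OF s, of a0] unfolding B_def by fastforce
  have "\<exists>X. (\<forall>n. X n \<in> left_variable_words L) \<and> (\<forall>w\<in>generated_words A X. \<exists>n. w0 @ w \<in> good n)"
  proof (rule generated_words_extend[where good = good and A = A, OF finite_A w0])
    fix n G assume G: "finite G" "G \<subseteq> good n"
    \<comment> \<open>Goodness of \<open>w\<close> at stage \<open>n\<close> covers each letter of
      \<open>A n\<close>; \<open>s_good\<close> lifts it to stage \<open>Suc n\<close>, and
      unfolding \<open>s a\<close> turns the words \<open>y\<close> into
      \<open>subst_var x a\<close>.\<close>
    have "r {x. w @ subst_var x a \<in> good (Suc n)}" if "w \<in> G" "a \<in> A n" for w a
      using s_good[of a w "Suc n"] that G A_L by (auto simp: good_def s_def ultra_map_def)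
    then have "r (\<Inter>(w, a)\<in>G \<times> A n. {x. w @ subst_var x a \<in> good (Suc n)})"
      using G finite_A by (intro ultra_INT[OF r(1)]) auto
    then have "r (left_variable_words L \<inter> (\<Inter>(w, a)\<in>G \<times> A n. {x. w @ subst_var x a \<in> good (Suc n)}))"
      using r by (simp add: ultra_Int)
    then have "left_variable_words L \<inter> (\<Inter>(w, a)\<in>G \<times> A n. {x. w @ subst_var x a \<in> good (Suc n)}) \<noteq> {}"
      using ultra_empty[OF r(1)] by (auto simp del: Int_iff)
    then obtain x where x: "x \<in> left_variable_words L \<inter>
        (\<Inter>(w, a)\<in>G \<times> A n. {x. w @ subst_var x a \<in> good (Suc n)})"
      by (auto simp only: ex_in_conv[symmetric])
    show "\<exists>x\<in>left_variable_words L. \<forall>w\<in>G. \<forall>a\<in>A n. w @ subst_var x a \<in> good (Suc n)"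
      by (rule bexI[of _ x]) (use x in auto)
  qed
  then obtain X where X: "\<And>n. X n \<in> left_variable_words L"
    "\<And>w. w \<in> generated_words A X \<Longrightarrow> \<exists>n. w0 @ w \<in> good n"
    by blast
  \<comment> \<open>Every good word lies in \<open>B\<close>, whatever its stage, so
    \<open>k\<close> is the common colour.\<close>
  have "monochromatic c {w0 @ w | w. w \<in> generated_words A X}"
    unfolding monochromatic_def
    by (rule exI[of _ k]) (use X(2) in \<open>auto simp: good_def B_def\<close>)
  moreover have "w0 \<in> lists L"
    using w0 by (simp add: good_def B_def)
  ultimately show ?thesis using X(1) by blast
qed

end
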